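(* Every non-compact cellular-compact $T_3$ space of countable spread has a subspace that is an S-space. Consequently, if there is no S-space, then every cellular-compact $T_3$ space of countable spread is compact.
   Context: $T_3$ means regular and $T_1$. A space has countable spread if each of its discrete subspaces is countable. An S-space is a $T_3$ space that is hereditarily separable but not hereditarily Lindelöf. A cellular family in a topological space is a family of pairwise disjoint non-empty open sets. A space $X$ is cellular-compact if for every cellular family $\mathcal{U}$ of open subsets of $X$ there is a compact subspace $K\subset X$ such that $K\cap U\neq\emptyset$ for each $U\in\mathcal{U}$. *)

theory Defs
  imports "HOL-Analysis.Analysis"
begin

text \<open>The library predicate \<open>regular_space\<close> does not include any point separation axiom.\<close>

definition t3_space :: "'a topology \<Rightarrow> bool" where
  "t3_space X \<longleftrightarrow> regular_space X \<and> t1_space X"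

definition countable_spread :: "'a topology \<Rightarrow> bool" where
  "countable_spread X \<longleftrightarrow>
     (\<forall>D. D \<subseteq> topspace X \<and> subtopology X D = discrete_topology D \<longrightarrow> countable D)"

definition hereditarily_separable :: "'a topology \<Rightarrow> bool" where
  "hereditarily_separable X \<longleftrightarrow> (\<forall>S. S \<subseteq> topspace X \<longrightarrow> separable_space (subtopology X S))"

definition hereditarily_Lindelof :: "'a topology \<Rightarrow> bool" where
  "hereditarily_Lindelof X \<longleftrightarrow> (\<forall>S. S \<subseteq> topspace X \<longrightarrow> Lindelof_space (subtopology X S))"

definition S_space :: "'a topology \<Rightarrow> bool" where
  "S_space X \<longleftrightarrow> t3_space X \<and> hereditarily_separable X \<and> \<not> hereditarily_Lindelof X"

definition cellular_family :: "'a topology \<Rightarrow> 'a set set \<Rightarrow> bool" where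
  "cellular_family X \<U> \<longleftrightarrow> (\<forall>U\<in>\<U>. openin X U \<and> U \<noteq> {}) \<and> pairwise disjnt \<U>"

definition cellular_compact :: "'a topology \<Rightarrow> bool" where
  "cellular_compact X \<longleftrightarrow>
     (\<forall>\<U>. cellular_family X \<U> \<longrightarrow> (\<exists>K. compactin X K \<and> (\<forall>U\<in>\<U>. K \<inter> U \<noteq> {})))"

end

theory Submission
  imports Defs
begin

text \<open>
  There are two independent reasons at work, and the Lindelof property tells them apart.

  In a cellular-compact space, countable open covers have finite subfamilies with dense union:
  otherwise the complements of the closures of finite unions form a decreasing sequence of non-empty
  open sets with empty intersection. Differences between its terms supply a cellular family with
  members inside every term, and no compact set can meet all of them
  (lemma \<open>cellular_compact_countable_cover\<close>). Regularity lets an arbitrary cover be refined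
  by one whose closures still fit into it, so a regular Lindelof cellular-compact space is compact.

  A space that is not Lindelof contains an uncountable right-separated subspace whose proper
  initial segments are countable, and such a subspace is again not Lindelof
  (\<open>not_Lindelof_imp_right_separated\<close>, \<open>right_separated_not_Lindelof\<close>). If the
  spread is countable, a right-separated subspace is hereditarily separable
  (\<open>right_separated_imp_hereditarily_separable\<close>): a dense subset of any part of it can be chosen
  left-separated, and a set that is both left- and right-separated by the same order is discrete.
  So in a non-compact cellular-compact \<open>T\<^sub>3\<close> space of countable spread, which cannot be
  Lindelof, such a subspace is an S-space.

  Both the right-separated subspace and the left-separated dense set come from one greedy
  selection along a well-order of all points. This makes ordinals unnecessary: countability of the
  initial segments is obtained by discarding the points that have uncountably many selected
  predecessors.
\<close>

section \<open>Compactness of regular Lindelof cellular-compact spaces\<close>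

text \<open>
  Let \<open>G n\<close> be the complement of the closures of the first \<open>n\<close> members, and suppose
  that it is never empty. Each point of \<open>G n\<close> lies in some member and hence outside the closure of a later \<open>G m\<close>. So along a
  suitable subsequence the sets \<open>G (e j) - closure (G (e (j+1)))\<close> are non-empty; a compact
  set meeting all of them would meet every \<open>G n\<close>, although finitely many members cover it.
\<close>

lemma cellular_compact_countable_cover:
  fixes W :: "nat \<Rightarrow> 'a set"
  assumes cc: "cellular_compact X"
    and opW: "\<And>n. openin X (W n)"
    and cover: "topspace X \<subseteq> (\<Union>n. W n)"
  shows "\<exists>n. topspace X \<subseteq> (\<Union>k<n. X closure_of W k)"
proof (rule ccontr)
  assume no: "\<nexists>n. topspace X \<subseteq> (\<Union>k<n. X closure_of W k)"
  define G where "G n = topspace X - (\<Union>k<n. X closure_of W k)" for n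
  have opG: "openin X (G n)" for n
    unfolding G_def by (intro openin_diff openin_topspace closedin_Union) auto
  have neG: "G n \<noteq> {}" for n
    using no unfolding G_def by blast
  have decG: "G n \<subseteq> G m" if "m \<le> n" for m n
    using that unfolding G_def by fastforce
  have disj: "W k \<inter> G n = {}" if "k < n" for k n
    using that closure_of_subset[OF openin_subset[OF opW[of k]]] unfolding G_def by blast
  have step: "\<exists>m>n. G n - X closure_of G m \<noteq> {}" for n
  proof -
    obtain x where x: "x \<in> G n" using neG by blast
    then have "x \<in> topspace X" unfolding G_def by blast
    then obtain k where k: "x \<in> W k" using cover by blast
    have "W k \<inter> G (Suc (max k n)) = {}" by (rule disj) simp
    then have "x \<notin> X closure_of G (Suc (max k n))"
      using k opW[of k] by (auto simp: in_closure_of)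
    moreover have "Suc (max k n) > n" by simp
    ultimately show ?thesis using x by blast
  qed
  then obtain N where N: "\<And>n. N n > n" "\<And>n. G n - X closure_of G (N n) \<noteq> {}"
    by metis
  define e where "e j = (N ^^ j) 0" for j
  have eSuc: "e (Suc j) = N (e j)" for j
    by (simp add: e_def)
  have mono: "strict_mono e"
    by (simp add: strict_mono_Suc_iff eSuc N(1))
  define V where "V j = G (e j) - X closure_of G (e (Suc j))" for j
  have opV: "openin X (V j)" for j
    unfolding V_def by (intro openin_diff opG closedin_closure_of)
  have neV: "V j \<noteq> {}" for j
    unfolding V_def eSuc by (rule N(2))
  have disjV: "V i \<inter> V j = {}" if "i < j" for i j
  proof -
    have "e (Suc i) \<le> e j"
      using that mono by (simp add: strict_mono_less_eq)
    then have "V j \<subseteq> G (e (Suc i))"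
      using decG unfolding V_def by blast
    moreover have "G (e (Suc i)) \<subseteq> X closure_of G (e (Suc i))"
      by (rule closure_of_subset[OF openin_subset[OF opG]])
    ultimately show ?thesis unfolding V_def[of i] by blast
  qed
  have "disjnt (V i) (V j)" if "V i \<noteq> V j" for i j
    using that disjV[of i j] disjV[of j i] by (cases i j rule: linorder_cases) (auto simp: disjnt_def)
  then have "cellular_family X (range V)"
    using opV neV by (auto simp: cellular_family_def pairwise_def)
  then obtain K where K: "compactin X K" and meets: "\<And>j. K \<inter> V j \<noteq> {}"
    using cc unfolding cellular_compact_def by (metis rangeI)
  have "K \<subseteq> \<Union>(range W)"
    using cover compactin_subset_topspace[OF K] by blast
  then obtain F where F: "finite F" "F \<subseteq> range W" "K \<subseteq> \<Union>F"
    using compactinD[OF K, of "range W"] opW by blast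
  obtain I where I: "finite I" "F = W ` I"
    using finite_subset_image[OF F(1,2)] by blast
  define n where "n = Suc (Max (insert 0 I))"
  have "K \<inter> G n = {}"
  proof -
    have "k < n" if "k \<in> I" for k
      using that I(1) unfolding n_def by (simp add: less_Suc_eq_le)
    then show ?thesis using disj F(3) I(2) by blast
  qed
  moreover have "V n \<subseteq> G n"
    using decG[OF strict_mono_imp_increasing[OF mono, of n]] unfolding V_def by blast
  ultimately show False using meets[of n] by blast
qed

lemma regular_Lindelof_cellular_compact_imp_compact:
  assumes reg: "regular_space X" and Lin: "Lindelof_space X" and cc: "cellular_compact X"
  shows "compact_space X"
proof (cases "topspace X = {}")
  case True
  then show ?thesis by (simp add: compact_space_def)
next
  case False
  show ?thesis
    unfolding compact_space_alt
  proof (intro allI impI, elim conjE)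
    fix \<U> assume op: "\<forall>U\<in>\<U>. openin X U" and cov: "topspace X \<subseteq> \<Union>\<U>"
    define \<W> where "\<W> = {W. openin X W \<and> (\<exists>U\<in>\<U>. X closure_of W \<subseteq> U)}"
    have "topspace X \<subseteq> \<Union>\<W>"
    proof
      fix x assume "x \<in> topspace X"
      then obtain U where U: "U \<in> \<U>" "x \<in> U" using cov by blast
      then obtain W C where "openin X W" "closedin X C" "x \<in> W" "W \<subseteq> C" "C \<subseteq> U"
        using reg op unfolding neighbourhood_base_of_closedin[symmetric] neighbourhood_base_of
        by metis
      moreover have "X closure_of W \<subseteq> C"
        using calculation by (simp add: closure_of_minimal)
      ultimately show "x \<in> \<Union>\<W>" using U(1) unfolding \<W>_def by blast
    qed
    moreover have "\<forall>W\<in>\<W>. openin X W" by (simp add: \<W>_def)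
    ultimately obtain \<V> where \<V>: "countable \<V>" "\<V> \<subseteq> \<W>" "topspace X \<subseteq> \<Union>\<V>"
      using Lin unfolding Lindelof_space_alt by meson
    then have ne: "\<V> \<noteq> {}" using False by blast
    define W where "W = from_nat_into \<V>"
    have rW: "range W = \<V>"
      unfolding W_def by (rule range_from_nat_into[OF ne \<V>(1)])
    then have inW: "W n \<in> \<W>" for n using \<V>(2) by blast
    obtain n where n: "topspace X \<subseteq> (\<Union>k<n. X closure_of W k)"
      using cellular_compact_countable_cover[OF cc, of W] inW \<V>(3) rW unfolding \<W>_def by blast
    obtain u where u: "\<And>k. u k \<in> \<U>" "\<And>k. X closure_of W k \<subseteq> u k"
      using inW unfolding \<W>_def by simp metis
    show "\<exists>\<F>. finite \<F> \<and> \<F> \<subseteq> \<U> \<and> topspace X \<subseteq> \<Union>\<F>"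
      using n u by (intro exI[of _ "u ` {..<n}"]) blast
  qed
qed

section \<open>Right-separated subspaces\<close>

text \<open>
  When \<open>R\<close> is a strict well-order, this says that \<open>Y\<close> is right-separated in the classical sense:
  every point has a neighbourhood avoiding all later points of \<open>Y\<close>, so that all initial segments
  are relatively open.
\<close>

definition right_separated :: "'a topology \<Rightarrow> 'a rel \<Rightarrow> 'a set \<Rightarrow> bool" where
  "right_separated X R Y \<longleftrightarrow> Y \<subseteq> topspace X \<and>
     (\<forall>y\<in>Y. \<exists>U. openin X U \<and> y \<in> U \<and> (\<forall>z\<in>Y \<inter> U. z = y \<or> (z, y) \<in> R))"

lemma right_separated_subset:
  assumes "right_separated X R Y" and "Z \<subseteq> Y"
  shows "right_separated X R Z"
  unfolding right_separated_def
proof (intro conjI ballI)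
  show "Z \<subseteq> topspace X" using assms unfolding right_separated_def by auto
  fix y assume "y \<in> Z"
  then obtain U where "openin X U" "y \<in> U" "\<forall>z\<in>Y \<inter> U. z = y \<or> (z, y) \<in> R"
    using assms unfolding right_separated_def by blast
  then show "\<exists>U. openin X U \<and> y \<in> U \<and> (\<forall>z\<in>Z \<inter> U. z = y \<or> (z, y) \<in> R)"
    using \<open>Z \<subseteq> Y\<close> by (intro exI[of _ U]) auto
qed

text \<open>
  The choices made by transfinite recursion: whether a point is selected depends on the set of its
  selected predecessors.
\<close>

lemma greedy_selection:
  assumes "wf R"
  obtains D where "\<And>x. x \<in> D \<longleftrightarrow> P x {y \<in> D. (y, x) \<in> R}"
proof
  define f where "f = wfrec R (\<lambda>g x. P x {y. (y, x) \<in> R \<and> g y})"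
  fix x
  have eq: "{y. (y, x) \<in> R \<and> cut f R x y} = {y \<in> Collect f. (y, x) \<in> R}"
    by (auto simp: cut_def)
  have "f x = P x {y. (y, x) \<in> R \<and> cut f R x y}"
    unfolding f_def by (rule wfrec[OF assms])
  then show "x \<in> Collect f \<longleftrightarrow> P x {y \<in> Collect f. (y, x) \<in> R}"
    unfolding eq by simp
qed

text \<open>
  Given a part \<open>S\<close>, select a point of \<open>S\<close> whenever it is outside the closure of the points
  selected before. The selected set is dense in \<open>S\<close>, and each of its points is isolated in it:
  the closure of the earlier selected points is avoided by construction, the later ones by
  right-separation. Countable spread makes it countable.
\<close>

lemma right_separated_imp_hereditarily_separable:
  assumes wf: "wf R" and rs: "right_separated X R Y" and spread: "countable_spread X"
  shows "hereditarily_separable (subtopology X Y)"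
  unfolding hereditarily_separable_def
proof (intro allI impI)
  fix S assume "S \<subseteq> topspace (subtopology X Y)"
  then have SY: "S \<subseteq> Y" and SX: "S \<subseteq> topspace X" by auto
  obtain D where D: "\<And>x. x \<in> D \<longleftrightarrow> x \<in> S \<and> x \<notin> X closure_of {y \<in> D. (y, x) \<in> R}"
    using greedy_selection[OF wf, of "\<lambda>x A. x \<in> S \<and> x \<notin> X closure_of A"] by blast
  have DS: "D \<subseteq> S" using D by blast
  then have DX: "D \<subseteq> topspace X" using SX by blast
  have "D \<inter> X derived_set_of D = {}"
  proof -
    have "x \<notin> X derived_set_of D" if x: "x \<in> D" for x
    proof -
      define C where "C = X closure_of {y \<in> D. (y, x) \<in> R}"
      have "x \<notin> C" using D x unfolding C_def by blast
      have "{y \<in> D. (y, x) \<in> R} \<subseteq> C"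
        unfolding C_def using DX by (intro closure_of_subset) blast
      moreover obtain U where U: "openin X U" "x \<in> U" "\<forall>z\<in>Y \<inter> U. z = x \<or> (z, x) \<in> R"
        using rs x DS SY unfolding right_separated_def by blast
      ultimately have only_x: "\<forall>z\<in>D \<inter> (U - C). z = x" using DS SY by blast
      have "openin X (U - C)"
        unfolding C_def by (intro openin_diff U(1) closedin_closure_of)
      moreover have "x \<in> U - C" using U(2) \<open>x \<notin> C\<close> by blast
      ultimately show ?thesis using only_x unfolding in_derived_set_of by blast
    qed
    then show ?thesis by blast
  qed
  then have "subtopology X D = discrete_topology D"
    using DX by (simp add: subtopology_eq_discrete_topology_eq)
  then have "countable D"
    using spread DX unfolding countable_spread_def by blast
  moreover have "S \<subseteq> X closure_of D"
  proof
    fix x assume "x \<in> S"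
    show "x \<in> X closure_of D"
    proof (cases "x \<in> D")
      case True
      then show ?thesis using closure_of_subset[OF DX] by blast
    next
      case False
      then have "x \<in> X closure_of {y \<in> D. (y, x) \<in> R}" using D \<open>x \<in> S\<close> by blast
      also have "\<dots> \<subseteq> X closure_of D" by (rule closure_of_mono) blast
      finally show ?thesis .
    qed
  qed
  ultimately have "separable_space (subtopology X S)"
    unfolding separable_space_def using DS SX
    by (intro exI[of _ D]) (auto simp: closure_of_subtopology inf.absorb2)
  then show "separable_space (subtopology (subtopology X Y) S)"
    using SY by (simp add: subtopology_subtopology inf.absorb2)
qed

text \<open>
  The separating neighbourhoods meet \<open>Y\<close> in countable sets, so countably many of them cannot
  cover it.
\<close>

lemma right_separated_not_Lindelof:
  assumes rs: "right_separated X R Y" and unc: "uncountable Y"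
    and seg: "\<And>y. y \<in> Y \<Longrightarrow> countable {z \<in> Y. (z, y) \<in> R}"
  shows "\<not> Lindelof_space (subtopology X Y)"
proof
  assume Lin: "Lindelof_space (subtopology X Y)"
  define \<U> where "\<U> = {U. openin X U \<and> countable (Y \<inter> U)}"
  have YX: "Y \<subseteq> topspace X" using rs unfolding right_separated_def by blast
  have "Y \<subseteq> \<Union>\<U>"
  proof
    fix y assume y: "y \<in> Y"
    then obtain U where U: "openin X U" "y \<in> U" "\<forall>z\<in>Y \<inter> U. z = y \<or> (z, y) \<in> R"
      using rs unfolding right_separated_def by blast
    then have "Y \<inter> U \<subseteq> insert y {z \<in> Y. (z, y) \<in> R}" by blast
    then have "countable (Y \<inter> U)"
      by (rule countable_subset) (simp add: seg[OF y])
    then show "y \<in> \<Union>\<U>" using U unfolding \<U>_def by blast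
  qed
  moreover have "\<forall>U\<in>\<U>. openin X U" by (simp add: \<U>_def)
  ultimately obtain \<V> where \<V>: "countable \<V>" "\<V> \<subseteq> \<U>" "Y \<subseteq> \<Union>\<V>"
    using Lin unfolding Lindelof_space_subtopology_subset[OF YX] by meson
  have "countable (\<Union>U\<in>\<V>. Y \<inter> U)"
    using \<V>(1,2) by (intro countable_UN) (auto simp: \<U>_def)
  moreover have "Y = (\<Union>U\<in>\<V>. Y \<inter> U)" using \<V>(3) by blast
  ultimately show False using unc by simp
qed

lemma ex_strict_wellorder:
  "\<exists>R :: 'a rel. wf R \<and> (\<forall>x y. x = y \<or> (x, y) \<in> R \<or> (y, x) \<in> R)"
proof -
  obtain r :: "'a rel" where r: "Well_order r \<and> Field r = UNIV"
    using well_ordering ..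
  show ?thesis
  proof (intro exI conjI allI)
    show "wf (r - Id)" using r by (simp add: well_order_on_def)
    show "x = y \<or> (x, y) \<in> r - Id \<or> (y, x) \<in> r - Id" for x y
      using r by (auto simp: well_order_on_def linear_order_on_def total_on_def)
  qed
qed

text \<open>
  Attach to each point \<open>x\<close> a member \<open>c x\<close> of a cover without countable subcover, and select
  the points not covered by the members attached to earlier selected points. These members cover the
  space, so uncountably many points \<open>Y\<close> are selected. The points \<open>Z\<close> with countably many
  predecessors in \<open>Y\<close> form an initial segment of \<open>Y\<close>. It is uncountable: otherwise the least point
  beyond it would belong to it.
\<close>

lemma not_Lindelof_imp_right_separated:
  assumes wf: "wf R" and total: "\<And>x y. x = y \<or> (x, y) \<in> R \<or> (y, x) \<in> R"
    and nL: "\<not> Lindelof_space X"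
  obtains Z where "right_separated X R Z" "uncountable Z"
    "\<And>z. z \<in> Z \<Longrightarrow> countable {w \<in> Z. (w, z) \<in> R}"
proof -
  obtain \<U> where \<U>: "\<forall>U\<in>\<U>. openin X U" "topspace X \<subseteq> \<Union>\<U>"
    "\<nexists>\<V>. countable \<V> \<and> \<V> \<subseteq> \<U> \<and> topspace X \<subseteq> \<Union>\<V>"
    using nL unfolding Lindelof_space_alt not_all not_imp by (elim exE conjE)
  have "\<forall>x\<in>topspace X. \<exists>U. U \<in> \<U> \<and> x \<in> U"
    using \<U>(2) by blast
  from bchoice[OF this] obtain c where c: "\<forall>x\<in>topspace X. c x \<in> \<U> \<and> x \<in> c x" ..
  obtain Y where Y: "\<And>x. x \<in> Y \<longleftrightarrow> x \<in> topspace X \<and> x \<notin> \<Union>(c ` {y \<in> Y. (y, x) \<in> R})"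
    using greedy_selection[OF wf, of "\<lambda>x A. x \<in> topspace X \<and> x \<notin> \<Union>(c ` A)"] by blast
  have YX: "Y \<subseteq> topspace X" using Y by blast
  have "topspace X \<subseteq> \<Union>(c ` Y)"
  proof
    fix x assume "x \<in> topspace X"
    then show "x \<in> \<Union>(c ` Y)" using Y[of x] c by (cases "x \<in> Y") auto
  qed
  moreover have "c ` Y \<subseteq> \<U>" using c YX by auto
  ultimately have unc: "uncountable Y"
    using \<U>(3) countable_image[of Y c] by metis
  have rsY: "right_separated X R Y"
    unfolding right_separated_def
  proof (intro conjI ballI YX)
    fix y assume y: "y \<in> Y"
    have "z = y \<or> (z, y) \<in> R" if "z \<in> Y \<inter> c y" for z
      using that y Y[of z] total[of z y] by blast
    then show "\<exists>U. openin X U \<and> y \<in> U \<and> (\<forall>z\<in>Y \<inter> U. z = y \<or> (z, y) \<in> R)"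
      using c y YX \<U>(1) by (intro exI[of _ "c y"]) auto
  qed
  define Z where "Z = {y \<in> Y. countable {z \<in> Y. (z, y) \<in> R}}"
  have ZY: "Z \<subseteq> Y" unfolding Z_def by blast
  have "uncountable Z"
  proof
    assume cZ: "countable Z"
    then have "Y - Z \<noteq> {}" using unc ZY by (metis Diff_eq_empty_iff countable_subset)
    then obtain y where y: "y \<in> Y - Z" and min: "\<And>z. (z, y) \<in> R \<Longrightarrow> z \<notin> Y - Z"
      using wfE_min'[OF wf] by metis
    have "{z \<in> Y. (z, y) \<in> R} \<subseteq> Z" using min by blast
    then have "countable {z \<in> Y. (z, y) \<in> R}" by (rule countable_subset[OF _ cZ])
    then have "y \<in> Z" using y unfolding Z_def by blast
    then show False using y by blast
  qed
  moreover have "countable {w \<in> Z. (w, z) \<in> R}" if "z \<in> Z" for z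
  proof (rule countable_subset)
    show "{w \<in> Z. (w, z) \<in> R} \<subseteq> {w \<in> Y. (w, z) \<in> R}" using ZY by blast
    show "countable {w \<in> Y. (w, z) \<in> R}" using that unfolding Z_def by blast
  qed
  ultimately show thesis
    using that right_separated_subset[OF rsY ZY] by blast
qed

lemma not_Lindelof_countable_spread_imp_S_subspace:
  assumes T3: "t3_space X" and spread: "countable_spread X" and nL: "\<not> Lindelof_space X"
  obtains S where "S \<subseteq> topspace X" "S_space (subtopology X S)"
proof -
  obtain R :: "'a rel" where "wf R \<and> (\<forall>x y. x = y \<or> (x, y) \<in> R \<or> (y, x) \<in> R)"
    using ex_strict_wellorder ..
  then have R: "wf R" "x = y \<or> (x, y) \<in> R \<or> (y, x) \<in> R" for x y
    by simp_all
  obtain Z where Z: "right_separated X R Z" "uncountable Z"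
    "\<And>z. z \<in> Z \<Longrightarrow> countable {w \<in> Z. (w, z) \<in> R}"
    by (rule not_Lindelof_imp_right_separated[OF R nL]) (rule that)
  show thesis
  proof
    show "Z \<subseteq> topspace X" using Z(1) unfolding right_separated_def by blast
    have "t3_space (subtopology X Z)"
      using T3 by (simp add: t3_space_def regular_space_subtopology t1_space_subtopology)
    moreover have "hereditarily_separable (subtopology X Z)"
      by (rule right_separated_imp_hereditarily_separable[OF R(1) Z(1) spread])
    moreover have "\<not> hereditarily_Lindelof (subtopology X Z)"
      using right_separated_not_Lindelof[OF Z] unfolding hereditarily_Lindelof_def
      by (metis order_refl subtopology_topspace)
    ultimately show "S_space (subtopology X Z)"
      unfolding S_space_def by blast
  qed
qed

section \<open>Non-compact cellular-compact spaces\<close>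

theorem corollary3p4:
  shows "(\<forall>X :: 'a topology.
            t3_space X \<and> cellular_compact X \<and> countable_spread X \<and> \<not> compact_space X
            \<longrightarrow> (\<exists>S. S \<subseteq> topspace X \<and> S_space (subtopology X S)))
       \<and> ((\<nexists>Y :: 'a topology. S_space Y)
            \<longrightarrow> (\<forall>X :: 'a topology.
                   t3_space X \<and> cellular_compact X \<and> countable_spread X \<longrightarrow> compact_space X))"
proof -
  have main: "\<exists>S. S \<subseteq> topspace X \<and> S_space (subtopology X S)"
    if "t3_space X" "cellular_compact X" "countable_spread X" "\<not> compact_space X"
    for X :: "'a topology"
  proof -
    have "\<not> Lindelof_space X"
      using that regular_Lindelof_cellular_compact_imp_compact unfolding t3_space_def by blast
    then show ?thesis
      using not_Lindelof_countable_spread_imp_S_subspace that(1,3) by metis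
  qed
  then show ?thesis by blast
qed

end
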